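(* Let $E$ be a polynomially convex regular compact subset of $\mathbb{C}$ and let $\omega$ be a modulus of continuity of $g_E$. Let $A=\{\zeta^{(n)}:n\ge1\}$ be an arbitrary array of distinct points in $E$, i.e. for each $n\ge1$, $\zeta^{(n)}=\{\zeta_0^{(n)},\dots,\zeta_n^{(n)}\}$ is an $(n+1)$-tuple of distinct points of $E$. For $k\in\{0,\dots,n\}$ put $\Delta_k^{(n)}=\prod_{l\in\{0,\dots,n\}\setminus\{k\}}(\zeta_k^{(n)}-\zeta_l^{(n)})$, let $j_n\in\{0,\dots,n\}$ be such that $|\Delta_{j_n}^{(n)}|=\min_{k\in\{0,\dots,n\}}|\Delta_k^{(n)}|$, and let $$L_n(z)=\frac{1}{\Delta_{j_n}^{(n)}}\prod_{k\in\{0,\dots,n\}\setminus\{j_n\}}(z-\zeta_k^{(n)}).$$ Then for each $n\geq 1$ and each $z\in D_n:=\{z\in\mathbb{C}:\mathrm{dist}(z,E)\ge1/n^2\}$, $$\frac1n\log\frac1{\|L_n\|_E}\le g_E(z)-\log\sqrt[n]{|L_n(z)|}\le\frac3n\log[(n+1)\Theta(E)]+\omega\Big(\frac1{n^2}\Big),$$ $$\frac1n\log\frac1{\|L_n\|_E}\le\log\frac{|\Delta_{j_n}^{(n)}|^{1/n}}{\mathrm{cap}\,E}\le\frac3n\log[(n+1)\Theta(E)]+\omega\Big(\frac1{n^2}\Big),$$ where $\Theta(E)=(2+\mathrm{diam}\,E)^{1/3}$.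
   Context: For compact $E\subset\mathbb{C}$, $\widehat E=\{z\in\mathbb{C}:|p(z)|\le\max_{w\in E}|p(w)|\text{ for every complex polynomial }p\}$; $E$ is polynomially convex if $E=\widehat E$. $E$ is regular if the Green function of $D_\infty=\mathbb{C}\setminus\widehat E$ with pole at infinity exists: a function $g_E$, harmonic and positive in $D_\infty$, with $g_E(z)\to0$ as $z\to\partial D_\infty$ and $g_E(z)-\log|z|\to\gamma\in\mathbb{R}$ as $z\to\infty$. It is extended by $0$ on $\widehat E$; $\mathrm{cap}\,E=e^{-\gamma}$. $\|\cdot\|_E$ is the sup norm on $E$. A modulus of continuity of $g_E$ is a function $\omega:[0,\infty)\to\mathbb{R}$ such that $\lim_{\delta\to0^+}\omega(\delta)=0$ and $g_E(z)\le\omega(\delta)$ whenever $\mathrm{dist}(z,E)<\delta$. *)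

theory Defs
  imports "HOL-Analysis.Analysis" "HOL-Computational_Algebra.Polynomial"
begin

definition sup_norm_on :: "complex set \<Rightarrow> (complex \<Rightarrow> complex) \<Rightarrow> real" where
  "sup_norm_on E f = (SUP w\<in>E. cmod (f w))"

text \<open>On a nonempty compact set the supremum of \<open>|p|\<close> is attained, so it is the maximum.\<close>

definition poly_hull :: "complex set \<Rightarrow> complex set" where
  "poly_hull E = {z. \<forall>p :: complex poly. cmod (poly p z) \<le> sup_norm_on E (poly p)}"

definition polynomially_convex :: "complex set \<Rightarrow> bool" where
  "polynomially_convex E \<longleftrightarrow> poly_hull E = E"

text \<open>Harmonicity on an open set: twice continuously differentiable with vanishing Laplacian.
  Here \<open>ux\<close>, \<open>uy\<close> are the first and \<open>uxx\<close>, \<open>uxy\<close>, \<open>uyx\<close>, \<open>uyy\<close> the second partial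
  derivatives of \<open>u\<close> with respect to the real and imaginary parts of the argument.\<close>

definition harmonic_on :: "complex set \<Rightarrow> (complex \<Rightarrow> real) \<Rightarrow> bool" where
  "harmonic_on U u \<longleftrightarrow> open U \<and>
    (\<exists>ux uy uxx uxy uyx uyy :: complex \<Rightarrow> real.
      (\<forall>z\<in>U. (u has_derivative (\<lambda>h. ux z * Re h + uy z * Im h)) (at z) \<and>
             (ux has_derivative (\<lambda>h. uxx z * Re h + uxy z * Im h)) (at z) \<and>
             (uy has_derivative (\<lambda>h. uyx z * Re h + uyy z * Im h)) (at z)) \<and>
      continuous_on U uxx \<and> continuous_on U uxy \<and>
      continuous_on U uyx \<and> continuous_on U uyy \<and>
      (\<forall>z\<in>U. uxx z + uyy z = 0))"

text \<open>The Green function of the complement of the hull with pole at infinity, including its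
  extension by \<open>0\<close> to the hull; this extension makes it unique as a function on the whole plane
  (by the maximum principle).\<close>

definition is_green_function :: "complex set \<Rightarrow> (complex \<Rightarrow> real) \<Rightarrow> bool" where
  "is_green_function E g \<longleftrightarrow>
     harmonic_on (- poly_hull E) g \<and>
     (\<forall>z\<in>- poly_hull E. 0 < g z) \<and>
     (\<forall>\<xi>\<in>frontier (- poly_hull E). (g \<longlongrightarrow> 0) (at \<xi> within - poly_hull E)) \<and>
     (\<exists>\<gamma>. ((\<lambda>z. g z - ln (cmod z)) \<longlongrightarrow> \<gamma>) at_infinity) \<and>
     (\<forall>z\<in>poly_hull E. g z = 0)"

definition regular_set :: "complex set \<Rightarrow> bool" where
  "regular_set E \<longleftrightarrow> (\<exists>g. is_green_function E g)"

definition green :: "complex set \<Rightarrow> complex \<Rightarrow> real" where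
  "green E = (THE g. is_green_function E g)"

definition robin_constant :: "complex set \<Rightarrow> real" where
  "robin_constant E = Lim at_infinity (\<lambda>z. green E z - ln (cmod z))"

definition log_capacity :: "complex set \<Rightarrow> real" where
  "log_capacity E = exp (- robin_constant E)"

text \<open>Only the values of \<open>\<omega>\<close> on \<open>[0, \<infinity>)\<close> are relevant. For nonempty \<open>E\<close>, \<open>infdist z E\<close> is the
  distance from \<open>z\<close> to \<open>E\<close>.\<close>

definition green_modulus_of_continuity :: "complex set \<Rightarrow> (real \<Rightarrow> real) \<Rightarrow> bool" where
  "green_modulus_of_continuity E \<omega> \<longleftrightarrow>
     (\<omega> \<longlongrightarrow> 0) (at_right 0) \<and>
     (\<forall>\<delta>\<ge>0. \<forall>z. infdist z E < \<delta> \<longrightarrow> green E z \<le> \<omega> \<delta>)"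

definition array_in :: "complex set \<Rightarrow> (nat \<Rightarrow> nat \<Rightarrow> complex) \<Rightarrow> bool" where
  "array_in E \<zeta> \<longleftrightarrow> (\<forall>n\<ge>1. inj_on (\<zeta> n) {0..n} \<and> \<zeta> n ` {0..n} \<subseteq> E)"

definition node_delta :: "(nat \<Rightarrow> nat \<Rightarrow> complex) \<Rightarrow> nat \<Rightarrow> nat \<Rightarrow> complex" where
  "node_delta \<zeta> n k = (\<Prod>l\<in>{0..n} - {k}. \<zeta> n k - \<zeta> n l)"

definition node_poly ::
  "(nat \<Rightarrow> nat \<Rightarrow> complex) \<Rightarrow> (nat \<Rightarrow> nat) \<Rightarrow> nat \<Rightarrow> complex \<Rightarrow> complex" where
  "node_poly \<zeta> j n z = 1 / node_delta \<zeta> n (j n) * (\<Prod>k\<in>{0..n} - {j n}. z - \<zeta> n k)"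

definition Theta :: "complex set \<Rightarrow> real" where
  "Theta E = (2 + diameter E) powr (1 / 3)"

end

theory Submission
  imports Defs
begin

text \<open>
  Let \<open>g\<close> be the Green function of \<open>E\<close> and \<open>L\<close> the polynomial of degree \<open>n\<close> attached to the nodes
  of level \<open>n\<close>; its zeros lie in \<open>E\<close> and its leading coefficient is \<open>1 / \<Delta>\<close>, where \<open>\<Delta>\<close> is the
  product \<open>\<Delta>\<^sub>k\<close> of least modulus. The function \<open>u = n g - ln |L|\<close> is harmonic outside \<open>E\<close>, since the
  logarithmic poles of the two terms at infinity cancel, and it tends to
  \<open>n \<gamma> + ln |\<Delta>| = n ln (|\<Delta>|\<^sup>1\<^sup>/\<^sup>n / cap E)\<close> at infinity. So the estimates for the node product
  \<open>|\<Delta>|\<close> are the limits at infinity of the estimates for \<open>u\<close>, and it remains to bound \<open>u\<close> from both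
  sides by the maximum principle.

  The lower bound \<open>u \<ge> - ln \<parallel>L\<parallel>\<close> is the Bernstein--Walsh inequality (lemma \<open>bernstein_walsh\<close>):
  at the boundary of \<open>E\<close> the function \<open>g\<close> vanishes and \<open>|L| \<le> \<parallel>L\<parallel>\<close>.

  For the upper bound, it suffices to bound \<open>u\<close> at distance exactly \<open>\<delta> = 1/n\<^sup>2\<close> from \<open>E\<close>
  (lemma \<open>green_le_ln_poly_of_level_set\<close>). There \<open>g \<le> \<omega>(\<delta>)\<close>, and \<open>|L|\<close> cannot be small: the
  Lagrange basis polynomials of the nodes sum to \<open>1\<close>, and, because \<open>\<Delta>\<close> has the least modulus, each of
  them is at most \<open>|L(z)| |z - \<zeta>\<^sub>j| / |z - \<zeta>\<^sub>k| \<le> |L(z)| (1 + diam E / \<delta>)\<close> in modulus. Hence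
  \<open>1 \<le> (n + 1) (1 + n\<^sup>2 diam E) |L(z)|\<close>, and the constant is at most
  \<open>(n + 1)\<^sup>3 (2 + diam E) = ((n + 1) \<Theta>(E))\<^sup>3\<close>.

  The regions are unbounded. Instead of a removable singularity at infinity, the
  maximum principle uses \<open>g\<close> itself: a function \<open>u\<close> with a finite limit at infinity is
  replaced by \<open>u + \<epsilon> g\<close>, which tends to infinity there, and then \<open>\<epsilon> \<rightarrow> 0\<close>
  (lemma \<open>harmonic_nonneg_of_boundary_and_infinity\<close>). The same argument shows that the Green
  function is unique, which makes its definition by unique description meaningful.
\<close>

section \<open>The minimum principle for harmonic functions\<close>

lemma second_derivative_nonneg_at_local_min:
  fixes f f' :: "real \<Rightarrow> real"
  assumes "d > 0" and min: "\<And>t. \<bar>t\<bar> < d \<Longrightarrow> f 0 \<le> f t"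
    and f': "\<And>t. \<bar>t\<bar> < d \<Longrightarrow> (f has_real_derivative f' t) (at t)"
    and f'': "(f' has_real_derivative c) (at 0)"
  shows "c \<ge> 0"
proof (rule ccontr)
  assume "\<not> c \<ge> 0"
  have "f' 0 = 0"
    using DERIV_local_min[OF f'[of 0] \<open>d > 0\<close>] min \<open>d > 0\<close> by simp
  then obtain e where e: "e > 0" "\<And>h. 0 < h \<Longrightarrow> h < e \<Longrightarrow> f' h < 0"
    using DERIV_neg_dec_right[OF f''] \<open>\<not> c \<ge> 0\<close> by auto
  define b where "b = min d e / 2"
  have b: "0 < b" "b < d" "b < e"
    using \<open>d > 0\<close> e(1) by (auto simp: b_def)
  have "continuous_on {0..b} f"
    using b by (intro continuous_at_imp_continuous_on ballI) (auto intro: DERIV_isCont[OF f'])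
  moreover have "\<exists>y. (f has_real_derivative y) (at x) \<and> y < 0" if "0 < x" "x < b" for x
    using f'[of x] e(2)[of x] that b by auto
  ultimately have "f b < f 0"
    using DERIV_neg_imp_decreasing_open[OF b(1)] by blast
  with min[of b] b show False by auto
qed

text \<open>Subtracting \<open>\<eta> |w - a|\<^sup>2\<close> makes the Laplacian equal to \<open>-4 \<eta> < 0\<close>, whereas at a local
  minimum both second derivatives along the coordinate axes would be nonnegative.\<close>

lemma harmonic_on_minus_quadratic_no_local_min:
  assumes "harmonic_on U h" and "\<eta> > 0" and "open W" "W \<subseteq> U" "z \<in> W"
  shows "\<exists>w\<in>W. h w - \<eta> * (cmod (w - a))\<^sup>2 < h z - \<eta> * (cmod (z - a))\<^sup>2"
proof (rule ccontr)
  assume contra: "\<not> ?thesis"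
  obtain ux uy uxx uxy uyx uyy where
    D: "\<And>z. z \<in> U \<Longrightarrow> (h has_derivative (\<lambda>k. ux z * Re k + uy z * Im k)) (at z)"
       "\<And>z. z \<in> U \<Longrightarrow> (ux has_derivative (\<lambda>k. uxx z * Re k + uxy z * Im k)) (at z)"
       "\<And>z. z \<in> U \<Longrightarrow> (uy has_derivative (\<lambda>k. uyx z * Re k + uyy z * Im k)) (at z)"
    and lap: "\<And>z. z \<in> U \<Longrightarrow> uxx z + uyy z = 0"
    using assms(1) unfolding harmonic_on_def by blast
  obtain d where d: "d > 0" "ball z d \<subseteq> W"
    using assms by (meson openE)
  \<comment> \<open>Along the line through \<open>z\<close> in direction \<open>e\<close>, the subtracted term has second derivative
      \<open>2 \<eta>\<close>.\<close>
  have second: "(uxx z * Re e + uxy z * Im e) * Re e + (uyx z * Re e + uyy z * Im e) * Im e \<ge> 2 * \<eta>"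
    if e: "cmod e = 1" for e
  proof -
    define f where "f t = h (z + of_real t * e) - \<eta> * (cmod (z + of_real t * e - a))\<^sup>2" for t :: real
    define f' where "f' t = ux (z + of_real t * e) * Re e + uy (z + of_real t * e) * Im e
       - \<eta> * (2 * ((z - a) \<bullet> e) + 2 * t)" for t :: real
    have e2: "Re e * Re e + Im e * Im e = 1"
      using e by (metis cmod_power2 power2_eq_square power_one)
    have quad: "(cmod (z + of_real t * e - a))\<^sup>2 = (cmod (z - a))\<^sup>2 + 2 * t * ((z - a) \<bullet> e) + t\<^sup>2" for t
    proof -
      have "(cmod (z + of_real t * e - a))\<^sup>2 = (cmod (z - a))\<^sup>2 + 2 * t * ((z - a) \<bullet> e) 
         + t\<^sup>2 * (Re e * Re e + Im e * Im e)"
        unfolding cmod_power2 inner_complex_def by (simp add: power2_eq_square algebra_simps)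
      then show ?thesis by (simp add: e2)
    qed
    have line: "((\<lambda>t. z + of_real t * e) has_derivative (\<lambda>s. of_real s * e)) (at t)" for t :: real
      by (auto intro!: derivative_eq_intros)
    have inU: "z + of_real t * e \<in> W" "z + of_real t * e \<in> U" if "\<bar>t\<bar> < d" for t
      using that d e assms(4) by (auto simp: dist_norm norm_mult subset_iff)
    have f': "(f has_real_derivative f' t) (at t)" if "\<bar>t\<bar> < d" for t
    proof -
      have "((\<lambda>t. h (z + of_real t * e)) has_derivative
             (\<lambda>s. (ux (z + of_real t * e) * Re e + uy (z + of_real t * e) * Im e) * s)) (at t)"
        by (rule has_derivative_eq_rhs[OF has_derivative_compose[OF line D(1)[OF inU(2)[OF that]]]])
           (auto simp: algebra_simps)
      then have "((\<lambda>t. h (z + of_real t * e)) has_real_derivative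
          ux (z + of_real t * e) * Re e + uy (z + of_real t * e) * Im e) (at t)"
        by (simp add: has_field_derivative_def)
      then show ?thesis
        unfolding f_def f'_def quad by (auto intro!: derivative_eq_intros simp: algebra_simps)
    qed
    have f'': "(f' has_real_derivative
       (uxx z * Re e + uxy z * Im e) * Re e + (uyx z * Re e + uyy z * Im e) * Im e - 2 * \<eta>) (at 0)"
    proof -
      have z: "z + of_real 0 * e \<in> U" using inU(2)[of 0] d by simp
      have "((\<lambda>t. ux (z + of_real t * e)) has_derivative
             (\<lambda>s. (uxx z * Re e + uxy z * Im e) * s)) (at 0)"
        by (rule has_derivative_eq_rhs[OF has_derivative_compose[OF line D(2)[OF z]]])
           (auto simp: algebra_simps)
      then have "((\<lambda>t. ux (z + of_real t * e)) has_real_derivative (uxx z * Re e + uxy z * Im e)) (at 0)"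
        by (simp add: has_field_derivative_def)
      moreover
      have "((\<lambda>t. uy (z + of_real t * e)) has_derivative
             (\<lambda>s. (uyx z * Re e + uyy z * Im e) * s)) (at 0)"
        by (rule has_derivative_eq_rhs[OF has_derivative_compose[OF line D(3)[OF z]]])
           (auto simp: algebra_simps)
      then have "((\<lambda>t. uy (z + of_real t * e)) has_real_derivative (uyx z * Re e + uyy z * Im e)) (at 0)"
        by (simp add: has_field_derivative_def)
      ultimately show ?thesis
        unfolding f'_def by (auto intro!: derivative_eq_intros simp: algebra_simps)
    qed
    have "f 0 \<le> f t" if "\<bar>t\<bar> < d" for t
      using contra inU(1)[OF that] unfolding f_def by (simp add: not_less)
    from second_derivative_nonneg_at_local_min[OF d(1) this f' f'']
    show ?thesis by simp
  qed
  have "uxx z + uyy z \<ge> 4 * \<eta>"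
    using second[of 1] second[of \<i>] by simp
  then show False
    using lap[of z] assms by force
qed

lemma harmonic_on_imp_continuous_on:
  assumes "harmonic_on U h" shows "continuous_on U h"
  using assms unfolding harmonic_on_def
  by (auto intro!: continuous_at_imp_continuous_on dest!: has_derivative_continuous)

text \<open>Compactness of the sublevel sets stands for all assumptions on the behaviour of \<open>h\<close> at the
  boundary and at infinity. If \<open>h z\<^sub>0 < s < m\<close>, then \<open>h - \<eta> |\<cdot> - z\<^sub>0|\<^sup>2\<close> attains a minimum over the
  sublevel set of \<open>s\<close>. For small \<open>\<eta>\<close> this minimum lies where \<open>h < s\<close>, which is an interior local
  minimum.\<close>

lemma harmonic_ge_of_compact_sublevels:
  assumes h: "harmonic_on U h" and comp: "\<And>c. c < m \<Longrightarrow> compact {z \<in> U. h z \<le> c}"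
    and "z\<^sub>0 \<in> U"
  shows "h z\<^sub>0 \<ge> m"
proof (rule ccontr)
  assume "\<not> h z\<^sub>0 \<ge> m"
  define s where "s = (h z\<^sub>0 + m) / 2"
  have s: "h z\<^sub>0 < s" "s < m" using \<open>\<not> h z\<^sub>0 \<ge> m\<close> by (auto simp: s_def)
  define K where "K = {z \<in> U. h z \<le> s}"
  have K: "compact K" "z\<^sub>0 \<in> K" using comp s assms(3) by (auto simp: K_def)
  obtain R where R: "R > 0" "\<And>z. z \<in> K \<Longrightarrow> cmod (z - z\<^sub>0) \<le> R"
    using compact_imp_bounded[OF K(1)] bounded_any_center[of K z\<^sub>0]
    by (metis dist_commute dist_norm less_max_iff_disj max.coboundedI1 zero_less_one)
  \<comment> \<open>With this \<open>\<eta>\<close> the quadratic term varies on \<open>K\<close> by less than the gap between \<open>h z\<^sub>0\<close> and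
      \<open>s\<close>.\<close>
  define \<eta> where "\<eta> = (s - h z\<^sub>0) / (2 * R\<^sup>2)"
  have \<eta>: "\<eta> > 0" "\<eta> * R\<^sup>2 < s - h z\<^sub>0" using s R by (auto simp: \<eta>_def)
  define v where "v z = h z - \<eta> * (cmod (z - z\<^sub>0))\<^sup>2" for z
  have cont: "continuous_on U h" using h by (rule harmonic_on_imp_continuous_on)
  have "continuous_on K v"
    unfolding v_def by (intro continuous_intros continuous_on_subset[OF cont]) (auto simp: K_def)
  then obtain z where z: "z \<in> K" "\<And>w. w \<in> K \<Longrightarrow> v z \<le> v w"
    using continuous_attains_inf[OF K(1)] K(2) by blast
  have "h z \<le> h z\<^sub>0 + \<eta> * (cmod (z - z\<^sub>0))\<^sup>2"
    using z(2)[OF K(2)] by (simp add: v_def)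
  also have "\<dots> \<le> h z\<^sub>0 + \<eta> * R\<^sup>2"
    using \<eta>(1) R(2)[OF z(1)] by (simp add: power_mono)
  also have "\<dots> < s" using \<eta>(2) by simp
  finally have "h z < s" .
  define W where "W = U \<inter> h -` {..<s}"
  have "open W"
    unfolding W_def using h cont
    by (intro continuous_open_preimage) (auto simp: harmonic_on_def)
  moreover have "z \<in> W" using \<open>h z < s\<close> z(1) by (auto simp: W_def K_def)
  ultimately obtain w where "w \<in> W" "v w < v z"
    using harmonic_on_minus_quadratic_no_local_min[OF h \<eta>(1), of W z z\<^sub>0]
    by (auto simp: W_def v_def)
  then show False using z(2)[of w] by (auto simp: W_def K_def)
qed

lemma harmonic_ge_of_boundary:
  assumes h: "harmonic_on U h"
    and bdry: "\<And>\<xi> c. \<xi> \<in> frontier U \<Longrightarrow> c < m \<Longrightarrow> \<forall>\<^sub>F z in at \<xi> within U. c < h z"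
    and inf: "filterlim h at_top at_infinity"
    and "z \<in> U"
  shows "h z \<ge> m"
proof (rule harmonic_ge_of_compact_sublevels[OF h _ \<open>z \<in> U\<close>])
  fix c assume "c < m"
  have U: "open U" using h by (simp add: harmonic_on_def)
  have cont: "continuous_on U h" using h by (rule harmonic_on_imp_continuous_on)
  let ?K = "{z \<in> U. h z \<le> c}"
  obtain b where b: "\<And>x. norm x \<ge> b \<Longrightarrow> c < h x"
    using inf unfolding filterlim_at_top_dense eventually_at_infinity by blast
  have "bounded ?K"
  proof (rule boundedI)
    show "norm z \<le> b" if "z \<in> ?K" for z
      using b[of z] that by (cases "b \<le> norm z") auto
  qed
  moreover have "closed ?K"
    unfolding closed_limpt
  proof (intro allI impI)
    fix \<xi> assume lim: "\<xi> islimpt ?K"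
    have no: False if ev: "\<forall>\<^sub>F z in at \<xi> within U. c < h z"
    proof -
      obtain T where T: "open T" "\<xi> \<in> T" "\<forall>x\<in>T. x \<noteq> \<xi> \<longrightarrow> x \<in> U \<longrightarrow> c < h x"
        using ev[unfolded eventually_at_topological] by auto
      obtain y where "y \<in> ?K" "y \<in> T" "y \<noteq> \<xi>"
        by (rule islimptE[OF lim T(2,1)])
      with T(3) show False by auto
    qed
    have "\<xi> \<in> closure U"
      using islimpt_subset[OF lim, of U] by (auto simp: closure_def)
    then have "\<xi> \<in> U"
      using no bdry[OF _ \<open>c < m\<close>] U by (auto simp: frontier_def interior_open)
    moreover have "h \<xi> \<le> c"
    proof (rule ccontr)
      assume "\<not> h \<xi> \<le> c"
      moreover have "(h \<longlongrightarrow> h \<xi>) (at \<xi> within U)"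
        using cont \<open>\<xi> \<in> U\<close> by (auto simp: continuous_on_def)
      ultimately show False
        using no by (auto simp: order_tendsto_iff)
    qed
    ultimately show "\<xi> \<in> ?K" by simp
  qed
  ultimately show "compact ?K" by (simp add: compact_eq_bounded_closed)
qed

section \<open>Closure properties of harmonic functions\<close>

lemma harmonic_on_add:
  assumes "harmonic_on U u" "harmonic_on U v"
  shows "harmonic_on U (\<lambda>z. u z + v z)"
proof -
  obtain ux uy uxx uxy uyx uyy where u:
    "\<And>z. z \<in> U \<Longrightarrow> (u has_derivative (\<lambda>h. ux z * Re h + uy z * Im h)) (at z)"
    "\<And>z. z \<in> U \<Longrightarrow> (ux has_derivative (\<lambda>h. uxx z * Re h + uxy z * Im h)) (at z)"
    "\<And>z. z \<in> U \<Longrightarrow> (uy has_derivative (\<lambda>h. uyx z * Re h + uyy z * Im h)) (at z)"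
    "continuous_on U uxx" "continuous_on U uxy" "continuous_on U uyx" "continuous_on U uyy"
    "\<And>z. z \<in> U \<Longrightarrow> uxx z + uyy z = 0" "open U"
    using assms(1) unfolding harmonic_on_def by blast
  obtain vx vy vxx vxy vyx vyy where v:
    "\<And>z. z \<in> U \<Longrightarrow> (v has_derivative (\<lambda>h. vx z * Re h + vy z * Im h)) (at z)"
    "\<And>z. z \<in> U \<Longrightarrow> (vx has_derivative (\<lambda>h. vxx z * Re h + vxy z * Im h)) (at z)"
    "\<And>z. z \<in> U \<Longrightarrow> (vy has_derivative (\<lambda>h. vyx z * Re h + vyy z * Im h)) (at z)"
    "continuous_on U vxx" "continuous_on U vxy" "continuous_on U vyx" "continuous_on U vyy"
    "\<And>z. z \<in> U \<Longrightarrow> vxx z + vyy z = 0"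
    using assms(2) unfolding harmonic_on_def by blast
  show ?thesis
    unfolding harmonic_on_def
  proof (intro conjI exI ballI)
    fix z assume "z \<in> U"
    show "((\<lambda>z. u z + v z) has_derivative (\<lambda>h. (ux z + vx z) * Re h + (uy z + vy z) * Im h)) (at z)"
      "((\<lambda>z. ux z + vx z) has_derivative (\<lambda>h. (uxx z + vxx z) * Re h + (uxy z + vxy z) * Im h)) (at z)"
      "((\<lambda>z. uy z + vy z) has_derivative (\<lambda>h. (uyx z + vyx z) * Re h + (uyy z + vyy z) * Im h)) (at z)"
      using has_derivative_add[OF u(1) v(1)] has_derivative_add[OF u(2) v(2)]
        has_derivative_add[OF u(3) v(3)] \<open>z \<in> U\<close>
      by (simp_all add: algebra_simps)
    show "uxx z + vxx z + (uyy z + vyy z) = 0"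
      using u(8)[of z] v(8)[of z] \<open>z \<in> U\<close> by linarith
  qed (use u(4-7,9) v(4-7) in \<open>auto intro!: continuous_intros\<close>)
qed

lemma harmonic_on_cmult:
  assumes "harmonic_on U u"
  shows "harmonic_on U (\<lambda>z. c * u z)"
proof -
  obtain ux uy uxx uxy uyx uyy where u:
    "\<And>z. z \<in> U \<Longrightarrow> (u has_derivative (\<lambda>h. ux z * Re h + uy z * Im h)) (at z)"
    "\<And>z. z \<in> U \<Longrightarrow> (ux has_derivative (\<lambda>h. uxx z * Re h + uxy z * Im h)) (at z)"
    "\<And>z. z \<in> U \<Longrightarrow> (uy has_derivative (\<lambda>h. uyx z * Re h + uyy z * Im h)) (at z)"
    "continuous_on U uxx" "continuous_on U uxy" "continuous_on U uyx" "continuous_on U uyy"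
    "\<And>z. z \<in> U \<Longrightarrow> uxx z + uyy z = 0" "open U"
    using assms(1) unfolding harmonic_on_def by blast
  show ?thesis
    unfolding harmonic_on_def
  proof (intro conjI exI ballI)
    fix z assume "z \<in> U"
    show "((\<lambda>z. c * u z) has_derivative (\<lambda>h. (c * ux z) * Re h + (c * uy z) * Im h)) (at z)"
      "((\<lambda>z. c * ux z) has_derivative (\<lambda>h. (c * uxx z) * Re h + (c * uxy z) * Im h)) (at z)"
      "((\<lambda>z. c * uy z) has_derivative (\<lambda>h. (c * uyx z) * Re h + (c * uyy z) * Im h)) (at z)"
      using has_derivative_mult_right[OF u(1), of z c] has_derivative_mult_right[OF u(2), of z c]
        has_derivative_mult_right[OF u(3), of z c] \<open>z \<in> U\<close>
      by (simp_all add: algebra_simps)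
    have "c * (uxx z + uyy z) = 0" using u(8) \<open>z \<in> U\<close> by simp
    then show "c * uxx z + c * uyy z = 0" by (simp only: distrib_left)
  qed (use u(4-7,9) in \<open>auto intro!: continuous_intros\<close>)
qed

lemma harmonic_on_const:
  assumes "open U" shows "harmonic_on U (\<lambda>z. c)"
  unfolding harmonic_on_def
  using assms by (intro conjI exI[of _ "\<lambda>_. 0::real"]) auto

lemma harmonic_on_diff:
  assumes "harmonic_on U u" "harmonic_on U v"
  shows "harmonic_on U (\<lambda>z. u z - v z)"
  using harmonic_on_add[OF assms(1) harmonic_on_cmult[OF assms(2), of "-1"]] by simp

lemma harmonic_on_sum:
  assumes "open U" and "\<And>k. k \<in> I \<Longrightarrow> harmonic_on U (u k)"
  shows "harmonic_on U (\<lambda>z. \<Sum>k\<in>I. u k z)"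
  using assms by (induction I rule: infinite_finite_induct) (auto intro: harmonic_on_const harmonic_on_add)

lemma harmonic_on_ln_cmod:
  assumes "open U" "a \<notin> U"
  shows "harmonic_on U (\<lambda>z. ln (cmod (z - a)))"
  unfolding harmonic_on_def
proof (intro conjI exI ballI)
  have ne: "z - a \<noteq> 0" if "z \<in> U" for z using assms that by auto
  have Re_deriv: "((\<lambda>z. Re (f z)) has_derivative (\<lambda>h. Re d * Re h + (- Im d) * Im h)) (at z)"
    if "(f has_field_derivative d) (at z)" for f d z
    using that unfolding has_field_derivative_def
    by (auto intro!: derivative_eq_intros)
  fix z assume z: "z \<in> U"
  \<comment> \<open>The gradient of \<open>ln |z - a|\<close> is given by the real parts of \<open>1 / (z - a)\<close> and
      \<open>\<i> / (z - a)\<close>; these are holomorphic, so the second derivatives come from complex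
      derivatives.\<close>
  show "((\<lambda>z. ln (cmod (z - a))) has_derivative
      (\<lambda>h. Re (1 / (z - a)) * Re h + Re (\<i> / (z - a)) * Im h)) (at z)"
  proof -
    have "((\<lambda>z. ln (cmod (z - a))) has_derivative
      (\<lambda>h. (h \<bullet> sgn (z - a)) / cmod (z - a))) (at z)"
    proof -
      have "((\<lambda>z. z - a) has_derivative (\<lambda>h. h)) (at z)"
        by (auto intro!: derivative_eq_intros)
      from has_derivative_compose[OF this has_derivative_norm[OF ne[OF z]]]
      show ?thesis
        using ne[OF z] by (auto intro!: derivative_eq_intros simp: field_simps)
    qed
    moreover have "(h \<bullet> sgn w) / cmod w = Re (1 / w) * Re h + Re (\<i> / w) * Im h" for h w
    proof -
      have "(h \<bullet> sgn w) / cmod w = (h \<bullet> w) / (cmod w)\<^sup>2"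
        by (simp add: sgn_div_norm power2_eq_square divide_inverse)
      then show ?thesis
        unfolding cmod_power2
        by (simp add: Re_divide inner_complex_def add_divide_distrib mult.commute)
    qed
    ultimately show ?thesis by simp
  qed
  have 1: "((\<lambda>z. 1 / (z - a)) has_field_derivative (-1 / (z - a)^2)) (at z)"
    using ne[OF z] by (auto intro!: derivative_eq_intros simp: power2_eq_square divide_simps)
  have 2: "((\<lambda>z. \<i> / (z - a)) has_field_derivative (-\<i> / (z - a)^2)) (at z)"
    using ne[OF z] by (auto intro!: derivative_eq_intros simp: power2_eq_square divide_simps)
  show "((\<lambda>z. Re (1 / (z - a))) has_derivative 
     (\<lambda>h. Re (-1 / (z - a)^2) * Re h + (- Im (-1 / (z - a)^2)) * Im h)) (at z)"
    using Re_deriv[OF 1] .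
  show "((\<lambda>z. Re (\<i> / (z - a))) has_derivative
     (\<lambda>h. Re (-\<i> / (z - a)^2) * Re h + (- Im (-\<i> / (z - a)^2)) * Im h)) (at z)"
    using Re_deriv[OF 2] .
  have "-\<i> / (z - a)^2 = \<i> * (-1 / (z - a)^2)" by simp
  then show "Re (-1 / (z - a)^2) + (- Im (-\<i> / (z - a)^2)) = 0"
    by (metis Im_i_times add.right_inverse)
qed (use assms in \<open>auto intro!: continuous_intros\<close>)

section \<open>The minimum principle at infinity and the Green function\<close>

text \<open>The limit \<open>l\<close> at infinity may have any sign: \<open>u + \<epsilon> g\<close> tends to infinity at infinity for
  every \<open>\<epsilon> > 0\<close>, so only the boundary values of \<open>u\<close> matter.\<close>

lemma harmonic_nonneg_of_boundary_and_infinity: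
  assumes u: "harmonic_on U u" and g: "harmonic_on U g"
    and g_nonneg: "\<And>z. z \<in> U \<Longrightarrow> g z \<ge> 0" and g_inf: "filterlim g at_top at_infinity"
    and bdry: "\<And>\<xi> c. \<xi> \<in> frontier U \<Longrightarrow> c < 0 \<Longrightarrow> \<forall>\<^sub>F z in at \<xi> within U. c < u z"
    and inf: "(u \<longlongrightarrow> l) at_infinity"
    and "z \<in> U"
  shows "u z \<ge> 0"
proof (rule ccontr)
  assume neg: "\<not> u z \<ge> 0"
  have perturbed: "u z + \<epsilon> * g z \<ge> 0" if "\<epsilon> > 0" for \<epsilon>
  proof (rule harmonic_ge_of_boundary[where h = "\<lambda>z. u z + \<epsilon> * g z" and U = U])
    show "harmonic_on U (\<lambda>z. u z + \<epsilon> * g z)"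
      by (intro harmonic_on_add harmonic_on_cmult u g)
    show "filterlim (\<lambda>z. u z + \<epsilon> * g z) at_top at_infinity"
      by (intro filterlim_tendsto_add_at_top[OF inf]
          filterlim_tendsto_pos_mult_at_top[OF tendsto_const that g_inf])
    fix \<xi> and c :: real assume "\<xi> \<in> frontier U" "c < 0"
    from bdry[OF this] have "\<forall>\<^sub>F z in at \<xi> within U. z \<in> U \<and> c < u z"
      unfolding eventually_at_filter by (rule eventually_mono) auto
    then show "\<forall>\<^sub>F z in at \<xi> within U. c < u z + \<epsilon> * g z"
    proof eventually_elim
      case (elim z)
      then have "0 \<le> \<epsilon> * g z" using g_nonneg[of z] that by simp
      with elim show ?case by linarith
    qed
  qed fact
  \<comment> \<open>Small enough that \<open>\<epsilon> g z < - u z\<close>; the summand \<open>1\<close> avoids a division by zero.\<close>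
  define \<epsilon> where "\<epsilon> = - u z / (2 * (g z + 1))"
  have gz: "g z + 1 > 0" using g_nonneg[OF \<open>z \<in> U\<close>] by simp
  then have "\<epsilon> > 0" using neg unfolding \<epsilon>_def by (intro divide_pos_pos) auto
  moreover have "\<epsilon> * (g z + 1) = - u z / 2" using gz by (simp add: \<epsilon>_def field_simps)
  ultimately show False
    using perturbed[of \<epsilon>] neg by (simp add: distrib_left)
qed

lemma filterlim_ln_cmod_at_infinity: "filterlim (\<lambda>z. ln (cmod z)) at_top at_infinity"
  by (rule filterlim_compose[OF ln_at_top filterlim_norm_at_top])

lemma green_at_infinity:
  assumes "is_green_function E g" shows "filterlim g at_top at_infinity"
proof -
  obtain \<gamma> where "((\<lambda>z. g z - ln (cmod z)) \<longlongrightarrow> \<gamma>) at_infinity"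
    using assms by (auto simp: is_green_function_def)
  from filterlim_tendsto_add_at_top[OF this filterlim_ln_cmod_at_infinity]
  show ?thesis by simp
qed

text \<open>The difference of two Green functions vanishes at the boundary and has a finite limit at
  infinity, so the minimum principle applies to it; by symmetry, Green functions are unique.\<close>

lemma green_function_le:
  assumes g: "is_green_function E g" and h: "is_green_function E h"
  shows "g z \<le> h z"
proof (cases "z \<in> poly_hull E")
  case True
  with g h show ?thesis by (auto simp: is_green_function_def)
next
  case False
  obtain \<gamma> where \<gamma>: "((\<lambda>z. g z - ln (cmod z)) \<longlongrightarrow> \<gamma>) at_infinity"
    using g by (auto simp: is_green_function_def)
  obtain \<gamma>' where \<gamma>': "((\<lambda>z. h z - ln (cmod z)) \<longlongrightarrow> \<gamma>') at_infinity"
    using h by (auto simp: is_green_function_def)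
  have "0 \<le> h z - g z"
  proof (rule harmonic_nonneg_of_boundary_and_infinity[where U = "- poly_hull E" and g = g
        and u = "\<lambda>z. h z - g z"])
    show "harmonic_on (- poly_hull E) (\<lambda>z. h z - g z)" "harmonic_on (- poly_hull E) g"
      using g h by (auto simp: is_green_function_def intro!: harmonic_on_diff)
    show "filterlim g at_top at_infinity" by (rule green_at_infinity[OF g])
    show "((\<lambda>z. h z - g z) \<longlongrightarrow> \<gamma>' - \<gamma>) at_infinity"
      using tendsto_diff[OF \<gamma>' \<gamma>] by simp
    show "g z \<ge> 0" if "z \<in> - poly_hull E" for z
      using g that by (auto simp: is_green_function_def less_imp_le)
    show "\<forall>\<^sub>F z in at \<xi> within - poly_hull E. c < h z - g z"
      if "\<xi> \<in> frontier (- poly_hull E)" "c < 0" for \<xi> c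
    proof -
      have "((\<lambda>z. h z - g z) \<longlongrightarrow> 0 - 0) (at \<xi> within - poly_hull E)"
        using g h that(1) unfolding is_green_function_def by (intro tendsto_diff) blast+
      with that(2) show ?thesis by (simp add: order_tendsto_iff)
    qed
  qed (use False in auto)
  then show ?thesis by simp
qed

lemma is_green_function_green:
  assumes "regular_set E" shows "is_green_function E (green E)"
proof -
  obtain g where g: "is_green_function E g" using assms by (auto simp: regular_set_def)
  then have "h = g" if "is_green_function E h" for h
    using that by (intro ext antisym green_function_le)
  with g show ?thesis
    unfolding green_def by (rule theI)
qed

lemma green_minus_ln_tendsto_robin_constant:
  assumes "regular_set E"
  shows "((\<lambda>z. green E z - ln (cmod z)) \<longlongrightarrow> robin_constant E) at_infinity"
proof -
  obtain \<gamma> where \<gamma>: "((\<lambda>z. green E z - ln (cmod z)) \<longlongrightarrow> \<gamma>) at_infinity"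
    using is_green_function_green[OF assms] by (auto simp: is_green_function_def)
  moreover have "robin_constant E = \<gamma>"
    unfolding robin_constant_def by (rule tendsto_Lim[OF trivial_limit_at_infinity \<gamma>])
  ultimately show ?thesis by simp
qed

section \<open>Polynomials with given zeros\<close>

lemma ln_cmod_diff_asymp: "((\<lambda>z. ln (cmod (z - a)) - ln (cmod z)) \<longlongrightarrow> 0) at_infinity"
proof (rule Lim_transform_eventually)
  have "((\<lambda>z. 1 - a / z) \<longlongrightarrow> 1 - 0) at_infinity"
    by (intro tendsto_diff tendsto_const tendsto_divide_0[OF tendsto_const] filterlim_ident)
  then have "((\<lambda>z. ln (cmod (1 - a / z))) \<longlongrightarrow> ln (cmod (1 - 0))) at_infinity"
    by (intro tendsto_ln tendsto_norm) auto
  then show "((\<lambda>z. ln (cmod (1 - a / z))) \<longlongrightarrow> 0) at_infinity" by simp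
  have "\<forall>\<^sub>F z in at_infinity. cmod z > cmod a"
    using filterlim_norm_at_top[where 'a = complex] by (simp add: filterlim_at_top_dense)
  then show "\<forall>\<^sub>F z in at_infinity. ln (cmod (1 - a / z)) = ln (cmod (z - a)) - ln (cmod z)"
  proof eventually_elim
    case (elim z)
    then have "z \<noteq> 0" "z \<noteq> a" by auto
    then have "1 - a / z = (z - a) / z" by (simp add: field_simps)
    with \<open>z \<noteq> 0\<close> \<open>z \<noteq> a\<close> show ?case by (simp add: norm_divide ln_div)
  qed
qed

text \<open>The zeros are indexed so that the definition covers the product over all nodes but one.\<close>

definition poly_with_zeros :: "complex \<Rightarrow> 'i set \<Rightarrow> ('i \<Rightarrow> complex) \<Rightarrow> complex \<Rightarrow> complex" where
  "poly_with_zeros c I a z = c * (\<Prod>k\<in>I. z - a k)"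

lemma poly_with_zeros_eq_0_iff:
  "finite I \<Longrightarrow> c \<noteq> 0 \<Longrightarrow> poly_with_zeros c I a z = 0 \<longleftrightarrow> z \<in> a ` I"
  by (auto simp: poly_with_zeros_def)

lemma continuous_on_poly_with_zeros: "continuous_on S (poly_with_zeros c I a)"
  unfolding poly_with_zeros_def by (intro continuous_intros)

lemma ln_cmod_poly_with_zeros:
  assumes "finite I" "c \<noteq> 0" "z \<notin> a ` I"
  shows "ln (cmod (poly_with_zeros c I a z)) = ln (cmod c) + (\<Sum>k\<in>I. ln (cmod (z - a k)))"
proof -
  have "(\<Prod>k\<in>I. cmod (z - a k)) \<noteq> 0" using assms by auto
  then have "ln (cmod (poly_with_zeros c I a z)) = ln (cmod c) + ln (\<Prod>k\<in>I. cmod (z - a k))"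
    using assms(2) by (simp add: poly_with_zeros_def norm_mult prod_norm ln_mult)
  also have "ln (\<Prod>k\<in>I. cmod (z - a k)) = (\<Sum>k\<in>I. ln (cmod (z - a k)))"
    using assms by (intro ln_prod) auto
  finally show ?thesis .
qed

lemma harmonic_on_transform:
  assumes "harmonic_on V u" "U \<subseteq> V" "open U" and eq: "\<And>z. z \<in> U \<Longrightarrow> u z = v z"
  shows "harmonic_on U v"
proof -
  obtain ux uy uxx uxy uyx uyy where u:
    "\<forall>z\<in>V. (u has_derivative (\<lambda>h. ux z * Re h + uy z * Im h)) (at z) \<and>
             (ux has_derivative (\<lambda>h. uxx z * Re h + uxy z * Im h)) (at z) \<and>
             (uy has_derivative (\<lambda>h. uyx z * Re h + uyy z * Im h)) (at z)"
    "continuous_on V uxx" "continuous_on V uxy" "continuous_on V uyx" "continuous_on V uyy"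
    "\<forall>z\<in>V. uxx z + uyy z = 0"
    using assms(1) unfolding harmonic_on_def by blast
  have v: "(v has_derivative f') (at z)" if "z \<in> U" "(u has_derivative f') (at z)" for z f'
    using has_derivative_transform_within_open[OF that(2) assms(3) that(1) eq] .
  show ?thesis
    unfolding harmonic_on_def
  proof (intro conjI exI ballI)
    fix z assume "z \<in> U"
    with \<open>U \<subseteq> V\<close> have "z \<in> V" by blast
    show "(v has_derivative (\<lambda>h. ux z * Re h + uy z * Im h)) (at z)"
      using v[OF \<open>z \<in> U\<close>] u(1) \<open>z \<in> V\<close> by blast
    show "(ux has_derivative (\<lambda>h. uxx z * Re h + uxy z * Im h)) (at z)"
      "(uy has_derivative (\<lambda>h. uyx z * Re h + uyy z * Im h)) (at z)" "uxx z + uyy z = 0"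
      using u(1,6) \<open>z \<in> V\<close> by blast+
  qed (use assms(2,3) u(2-5)[THEN continuous_on_subset] in blast)+
qed

lemma harmonic_on_ln_cmod_poly_with_zeros:
  assumes "open U" "finite I" "c \<noteq> 0" "a ` I \<inter> U = {}"
  shows "harmonic_on U (\<lambda>z. ln (cmod (poly_with_zeros c I a z)))"
proof (rule harmonic_on_transform)
  show "harmonic_on U (\<lambda>z. ln (cmod c) + (\<Sum>k\<in>I. ln (cmod (z - a k))))"
    using assms by (intro harmonic_on_add harmonic_on_const harmonic_on_sum harmonic_on_ln_cmod) auto
  show "ln (cmod c) + (\<Sum>k\<in>I. ln (cmod (z - a k))) = ln (cmod (poly_with_zeros c I a z))"
    if "z \<in> U" for z
    using assms that by (subst ln_cmod_poly_with_zeros) auto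
qed (use assms in auto)

lemma ln_cmod_poly_with_zeros_asymp:
  assumes "finite I" "c \<noteq> 0"
  shows "((\<lambda>z. ln (cmod (poly_with_zeros c I a z)) - real (card I) * ln (cmod z))
           \<longlongrightarrow> ln (cmod c)) at_infinity"
proof (rule Lim_transform_eventually)
  have "((\<lambda>z. ln (cmod c) + (\<Sum>k\<in>I. ln (cmod (z - a k)) - ln (cmod z)))
          \<longlongrightarrow> ln (cmod c) + (\<Sum>k\<in>I. 0)) at_infinity"
    by (intro tendsto_intros ln_cmod_diff_asymp)
  then show "((\<lambda>z. ln (cmod c) + (\<Sum>k\<in>I. ln (cmod (z - a k)) - ln (cmod z)))
          \<longlongrightarrow> ln (cmod c)) at_infinity" by simp
  have "bounded (a ` I)" using assms by (intro finite_imp_bounded) auto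
  then obtain b where b: "\<And>k. k \<in> I \<Longrightarrow> cmod (a k) \<le> b"
    by (auto simp: bounded_iff)
  have "\<forall>\<^sub>F z in at_infinity. cmod z > b"
    using filterlim_norm_at_top[where 'a = complex] by (simp add: filterlim_at_top_dense)
  then show "\<forall>\<^sub>F z in at_infinity. ln (cmod c) + (\<Sum>k\<in>I. ln (cmod (z - a k)) - ln (cmod z))
       = ln (cmod (poly_with_zeros c I a z)) - real (card I) * ln (cmod z)"
  proof eventually_elim
    case (elim z)
    then have "z \<notin> a ` I" using b by force
    with assms show ?case by (simp add: ln_cmod_poly_with_zeros sum_subtractf)
  qed
qed

text \<open>The Lagrange interpolation polynomial of the constant \<open>1\<close> has degree less than the number of
  nodes, hence it is \<open>1\<close>.\<close>

lemma sum_lagrange_basis_eq_1: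
  fixes x :: "'i \<Rightarrow> 'a :: field"
  assumes "finite I" "I \<noteq> {}" "inj_on x I"
  shows "(\<Sum>k\<in>I. (\<Prod>l\<in>I - {k}. z - x l) / (\<Prod>l\<in>I - {k}. x k - x l)) = 1"
proof -
  define q where "q k = (\<Prod>l\<in>I - {k}. [:- x l, 1:])" for k
  define p where "p = (\<Sum>k\<in>I. smult (1 / (\<Prod>l\<in>I - {k}. x k - x l)) (q k))"
  have q: "poly (q k) w = (\<Prod>l\<in>I - {k}. w - x l)" for k w
    by (simp add: q_def poly_prod)
  have "p = 1"
  proof (rule poly_eqI_degree)
    have card: "card (x ` I) = card I" using assms by (simp add: card_image)
    have "card I > 0" using assms by (simp add: card_gt_0_iff)
    then show "degree (1 :: 'a poly) < card (x ` I)" using card by simp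
    have "degree (q k) \<le> card I - 1" if "k \<in> I" for k
      using degree_prod_sum_le[of "I - {k}" "\<lambda>l. [:- x l, 1:]"] assms that by (simp add: q_def)
    then have "degree p \<le> card I - 1"
      unfolding p_def by (intro degree_sum_le assms) (meson degree_smult_le order_trans)
    then show "degree p < card (x ` I)" using card \<open>card I > 0\<close> by simp
    fix w assume "w \<in> x ` I"
    then obtain m where m: "m \<in> I" "w = x m" by blast
    have nz: "(\<Prod>l\<in>I - {m}. x m - x l) \<noteq> 0"
      using assms m by (auto simp: inj_on_def)
    have "poly p w = (\<Sum>k\<in>I. (\<Prod>l\<in>I - {k}. x m - x l) / (\<Prod>l\<in>I - {k}. x k - x l))"
      by (simp add: p_def poly_sum q m)
    also have "\<dots> = (\<Sum>k\<in>I. if k = m then 1 else 0)"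
    proof (intro sum.cong refl)
      fix k assume "k \<in> I"
      then show "(\<Prod>l\<in>I - {k}. x m - x l) / (\<Prod>l\<in>I - {k}. x k - x l) = (if k = m then 1 else 0)"
        using m nz assms(1) by auto
    qed
    also have "\<dots> = 1" using assms m by simp
    finally show "poly p w = poly 1 w" by simp
  qed
  then have "poly p z = 1" by simp
  then show ?thesis by (simp add: p_def poly_sum q)
qed

section \<open>Comparing the Green function with polynomials\<close>

lemma cmod_le_sup_norm_on:
  assumes "compact E" "continuous_on E f" "w \<in> E"
  shows "cmod (f w) \<le> sup_norm_on E f"
  unfolding sup_norm_on_def
proof (rule cSUP_upper[OF assms(3)])
  have "compact ((\<lambda>w. cmod (f w)) ` E)"
    using assms by (intro compact_continuous_image continuous_intros)
  then show "bdd_above ((\<lambda>w. cmod (f w)) ` E)"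
    by (simp add: bounded_imp_bdd_above compact_imp_bounded)
qed

lemma harmonic_on_green:
  assumes "polynomially_convex E" "regular_set E"
  shows "harmonic_on (- E) (green E)"
  using is_green_function_green[OF assms(2)] assms(1)
  by (simp add: is_green_function_def polynomially_convex_def)

lemma green_nonneg: "regular_set E \<Longrightarrow> green E z \<ge> 0"
  using is_green_function_green[of E]
  by (cases "z \<in> poly_hull E") (auto simp: is_green_function_def less_imp_le)

lemma green_minus_ln_poly_tendsto:
  assumes "regular_set E" and "finite I" "c \<noteq> 0"
  shows "((\<lambda>z. real (card I) * green E z - ln (cmod (poly_with_zeros c I a z)))
           \<longlongrightarrow> real (card I) * robin_constant E - ln (cmod c)) at_infinity"
proof -
  have "((\<lambda>z. real (card I) * (green E z - ln (cmod z))
            - (ln (cmod (poly_with_zeros c I a z)) - real (card I) * ln (cmod z)))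
           \<longlongrightarrow> real (card I) * robin_constant E - ln (cmod c)) at_infinity"
    by (intro tendsto_intros green_minus_ln_tendsto_robin_constant ln_cmod_poly_with_zeros_asymp assms)
  then show ?thesis by (simp add: algebra_simps)
qed

text \<open>At a boundary point \<open>\<xi>\<close> where the polynomial vanishes, the logarithm tends to minus infinity. Comparing
  \<open>|P|\<close> with \<open>N exp (-e)\<close> for \<open>e < 0\<close>, before taking logarithms, treats these points like the
  others. The point \<open>w\<close> guarantees that the supremum norm is positive.\<close>

lemma bernstein_walsh:
  assumes E: "compact E" "polynomially_convex E" "regular_set E"
    and I: "finite I" "c \<noteq> 0" "a ` I \<subseteq> E"
    and w: "w \<in> E" "poly_with_zeros c I a w \<noteq> 0" and "z \<notin> E"
  shows "ln (cmod (poly_with_zeros c I a z))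
           \<le> real (card I) * green E z + ln (sup_norm_on E (poly_with_zeros c I a))"
proof -
  define P where "P = poly_with_zeros c I a"
  define N where "N = sup_norm_on E P"
  have bound: "cmod (P \<xi>) \<le> N" if "\<xi> \<in> E" for \<xi>
    unfolding N_def P_def using E(1) that
    by (intro cmod_le_sup_norm_on continuous_on_poly_with_zeros)
  have "N > 0" using bound[OF w(1)] w(2) unfolding P_def
    by (meson zero_less_norm_iff less_le_trans)
  have hull: "poly_hull E = E" using E(2) by (simp add: polynomially_convex_def)
  have "open (- E)" using E(1) by (simp add: compact_imp_closed open_Compl)
  have green: "is_green_function E (green E)" using E(3) by (rule is_green_function_green)
  have "0 \<le> real (card I) * green E z - ln (cmod (P z)) + ln N"
  proof (rule harmonic_nonneg_of_boundary_and_infinity[where U = "- E" and g = "green E"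
        and u = "\<lambda>z. real (card I) * green E z - ln (cmod (P z)) + ln N"])
    show "harmonic_on (- E) (green E)" by (rule harmonic_on_green[OF E(2,3)])
    then show "harmonic_on (- E) (\<lambda>z. real (card I) * green E z - ln (cmod (P z)) + ln N)"
      unfolding P_def using I \<open>open (- E)\<close>
      by (intro harmonic_on_add harmonic_on_diff harmonic_on_cmult harmonic_on_const
          harmonic_on_ln_cmod_poly_with_zeros) auto
    show "filterlim (green E) at_top at_infinity" by (rule green_at_infinity[OF green])
    show "((\<lambda>z. real (card I) * green E z - ln (cmod (P z)) + ln N) \<longlongrightarrow>
      real (card I) * robin_constant E - ln (cmod c) + ln N) at_infinity"
      unfolding P_def by (intro tendsto_add tendsto_const green_minus_ln_poly_tendsto E I)
    show "green E z \<ge> 0" for z by (rule green_nonneg[OF E(3)])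
    fix \<xi> and e :: real assume \<xi>: "\<xi> \<in> frontier (- E)" and "e < 0"
    then have "\<xi> \<in> E"
      using E(1) by (metis frontier_complement frontier_subset_closed compact_imp_closed subsetD)
    have "cmod (P \<xi>) < N * exp (- e)"
      using bound[OF \<open>\<xi> \<in> E\<close>] \<open>N > 0\<close> \<open>e < 0\<close>
      by (smt (verit) mult_less_cancel_left_pos mult_cancel_left2 exp_gt_one mult.right_neutral)
    moreover have "((\<lambda>z. cmod (P z)) \<longlongrightarrow> cmod (P \<xi>)) (at \<xi> within - E)"
      using continuous_on_poly_with_zeros[of UNIV c I a] unfolding P_def
      by (intro tendsto_norm) (auto simp: continuous_on_def intro: tendsto_within_subset)
    ultimately have "\<forall>\<^sub>F z in at \<xi> within - E. cmod (P z) < N * exp (- e)"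
      by (simp add: order_tendsto_iff)
    moreover have "\<forall>\<^sub>F z in at \<xi> within - E. z \<in> - E"
      by (simp add: eventually_at_filter)
    ultimately show "\<forall>\<^sub>F z in at \<xi> within - E. e < real (card I) * green E z - ln (cmod (P z)) + ln N"
    proof eventually_elim
      case (elim z)
      then have "P z \<noteq> 0" using I by (auto simp: P_def poly_with_zeros_eq_0_iff)
      then have "ln (cmod (P z)) < ln (N * exp (- e))"
        using elim(1) by (intro ln_less_cancel_iff[THEN iffD2]) (auto intro: less_trans[of 0 "cmod (P z)"])
      also have "\<dots> = ln N - e" using \<open>N > 0\<close> by (simp add: ln_mult)
      finally have "e < - ln (cmod (P z)) + ln N" by simp
      moreover have "0 \<le> real (card I) * green E z" using green_nonneg[OF E(3)] by simp
      ultimately show ?case by linarith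
    qed
  qed (use \<open>z \<notin> E\<close> in auto)
  then show ?thesis by (simp add: P_def N_def)
qed

text \<open>The modulus of continuity controls only points at distance strictly less than \<open>\<delta>\<close>. A point at
  distance exactly \<open>\<delta>\<close> is approached by such points on the segment towards a nearest point of
  \<open>E\<close>.\<close>

lemma green_le_modulus_at_distance:
  assumes E: "compact E" "polynomially_convex E" "regular_set E" "E \<noteq> {}"
    and \<omega>: "green_modulus_of_continuity E \<omega>" and "\<delta> > 0" and z: "infdist z E = \<delta>"
  shows "green E z \<le> \<omega> \<delta>"
proof -
  obtain y where y: "y \<in> E" "infdist z E = dist z y"
    using infdist_attains_inf compact_imp_closed E by metis
  define w where "w t = z + of_real t * (y - z)" for t :: real
  have "z \<notin> E" using z \<open>\<delta> > 0\<close> by auto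
  have "isCont (green E) z"
    using harmonic_on_imp_continuous_on[OF harmonic_on_green[OF E(2,3)]] E(1) \<open>z \<notin> E\<close>
    by (simp add: continuous_on_eq_continuous_at compact_imp_closed open_Compl)
  moreover have "(w \<longlongrightarrow> w 0) (at_right 0)"
    unfolding w_def by (intro tendsto_intros)
  ultimately have "((\<lambda>t. green E (w t)) \<longlongrightarrow> green E z) (at_right 0)"
    using isCont_tendsto_compose[of z "green E" w] by (simp add: w_def)
  moreover have "\<forall>\<^sub>F t in at_right 0. green E (w t) \<le> \<omega> \<delta>"
    unfolding eventually_at_right_field
  proof (intro exI[of _ 1] conjI allI impI)
    fix t :: real assume t: "0 < t" "t < 1"
    have "w t - y = of_real (1 - t) * (z - y)"
      by (simp add: w_def algebra_simps)
    then have "dist (w t) y = (1 - t) * dist z y"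
      using t by (simp add: dist_norm norm_mult del: of_real_diff)
    also have "\<dots> < \<delta>" using t y z \<open>\<delta> > 0\<close> by simp
    finally have "infdist (w t) E < \<delta>" using infdist_le[OF y(1), of "w t"] by linarith
    then show "green E (w t) \<le> \<omega> \<delta>"
      using \<omega> \<open>\<delta> > 0\<close> unfolding green_modulus_of_continuity_def by (meson less_imp_le)
  qed simp
  ultimately show ?thesis
    by (rule tendsto_upperbound) simp
qed

text \<open>This is the minimum principle for \<open>ln |P| - n g + M\<close> in the region at distance more than
  \<open>\<delta>\<close> from \<open>E\<close>, where \<open>P\<close> is the polynomial and \<open>n\<close> its degree: the logarithmic growth at infinity
  cancels, and the function is continuous on the closure of the region.\<close>

lemma green_le_ln_poly_of_level_set:
  assumes E: "compact E" "polynomially_convex E" "regular_set E" "E \<noteq> {}"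
    and I: "finite I" "c \<noteq> 0" "a ` I \<subseteq> E" and "\<delta> > 0"
    and level: "\<And>\<xi>. infdist \<xi> E = \<delta> \<Longrightarrow>
        real (card I) * green E \<xi> \<le> ln (cmod (poly_with_zeros c I a \<xi>)) + M"
    and z: "infdist z E \<ge> \<delta>"
  shows "real (card I) * green E z \<le> ln (cmod (poly_with_zeros c I a z)) + M"
proof (cases "infdist z E = \<delta>")
  case True
  then show ?thesis by (rule level)
next
  case False
  define U where "U = {z. infdist z E > \<delta>}"
  define u where "u z = ln (cmod (poly_with_zeros c I a z)) - real (card I) * green E z + M" for z
  have "open U" unfolding U_def by (intro open_Collect_less continuous_intros)
  have "closed {z. infdist z E \<ge> \<delta>}" by (intro closed_Collect_le continuous_intros)
  then have "closure U \<subseteq> {z. infdist z E \<ge> \<delta>}"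
    by (intro closure_minimal) (auto simp: U_def)
  then have front: "infdist \<xi> E = \<delta>" if "\<xi> \<in> frontier U" for \<xi>
    using that \<open>open U\<close> by (force simp: frontier_def interior_open U_def)
  have "open (- E)" using E(1) by (simp add: compact_imp_closed open_Compl)
  have u: "harmonic_on (- E) u"
    unfolding u_def using I \<open>open (- E)\<close>
    by (intro harmonic_on_add harmonic_on_diff harmonic_on_cmult harmonic_on_const
        harmonic_on_ln_cmod_poly_with_zeros harmonic_on_green E) auto
  have disj: "x \<notin> E" if "infdist x E \<ge> \<delta>" for x using that \<open>\<delta> > 0\<close> by auto
  have "U \<subseteq> - E" using disj by (auto simp: U_def)
  have "0 \<le> u z"
  proof (rule harmonic_nonneg_of_boundary_and_infinity[where U = U and g = "green E" and u = u])
    show "harmonic_on U u" "harmonic_on U (green E)"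
      using harmonic_on_transform[OF _ \<open>U \<subseteq> - E\<close> \<open>open U\<close> refl] u harmonic_on_green[OF E(2,3)] by auto
    show "filterlim (green E) at_top at_infinity"
      by (rule green_at_infinity[OF is_green_function_green[OF E(3)]])
    have "((\<lambda>z. - (real (card I) * green E z - ln (cmod (poly_with_zeros c I a z))) + M)
       \<longlongrightarrow> - (real (card I) * robin_constant E - ln (cmod c)) + M) at_infinity"
      by (intro tendsto_add tendsto_minus tendsto_const green_minus_ln_poly_tendsto E I)
    then show "(u \<longlongrightarrow> - (real (card I) * robin_constant E - ln (cmod c)) + M) at_infinity"
      by (simp add: u_def[abs_def])
    show "green E z \<ge> 0" for z by (rule green_nonneg[OF E(3)])
    show "\<forall>\<^sub>F z in at \<xi> within U. e < u z" if "\<xi> \<in> frontier U" "e < 0" for \<xi> e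
    proof -
      have "\<xi> \<notin> E" using disj[of \<xi>] front[OF that(1)] by simp
      then have "isCont u \<xi>"
        using harmonic_on_imp_continuous_on[OF u] \<open>open (- E)\<close>
        by (simp add: continuous_on_eq_continuous_at)
      then have "(u \<longlongrightarrow> u \<xi>) (at \<xi> within U)"
        unfolding isCont_def by (rule tendsto_within_subset) simp
      moreover have "e < u \<xi>" using level[OF front[OF that(1)]] that(2) by (simp add: u_def)
      ultimately show ?thesis by (simp add: order_tendsto_iff)
    qed
  qed (use z False in \<open>auto simp: U_def\<close>)
  then show ?thesis by (simp add: u_def)
qed

section \<open>Lower bound for the node polynomial away from the set\<close>

text \<open>Writing \<open>L\<close> for the polynomial in the conclusion, the \<open>k\<close>-th Lagrange basis polynomial
  equals \<open>L(z) (\<Delta>\<^sub>j / \<Delta>\<^sub>k) (z - x\<^sub>j) / (z - x\<^sub>k)\<close>. The choice of \<open>j\<close> bounds the second factor by \<open>1\<close>,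
  and the last quotient is at most \<open>1 + diam E / \<delta>\<close>. The basis sums to \<open>1\<close>.\<close>

lemma lagrange_basis_lower_bound:
  fixes x :: "'i \<Rightarrow> complex"
  assumes I: "finite I" "inj_on x I" "x ` I \<subseteq> E" and E: "bounded E" and "\<delta> > 0"
    and z: "infdist z E \<ge> \<delta>" and j: "j \<in> I"
    and min: "\<And>k. k \<in> I \<Longrightarrow> cmod (\<Prod>l\<in>I - {j}. x j - x l) \<le> cmod (\<Prod>l\<in>I - {k}. x k - x l)"
  shows "1 \<le> real (card I) * (1 + diameter E / \<delta>)
           * cmod (poly_with_zeros (1 / (\<Prod>l\<in>I - {j}. x j - x l)) (I - {j}) x z)"
proof -
  define \<Delta> where "\<Delta> k = (\<Prod>l\<in>I - {k}. x k - x l)" for k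
  define L where "L = cmod (poly_with_zeros (1 / \<Delta> j) (I - {j}) x z)"
  have \<Delta>: "\<Delta> k \<noteq> 0" if "k \<in> I" for k
    using I that by (auto simp: \<Delta>_def inj_on_def)
  have dist: "cmod (z - x k) \<ge> \<delta>" if "k \<in> I" for k
    using infdist_le[of "x k" E z] I(3) z that by (force simp: dist_norm)
  have "cmod ((\<Prod>l\<in>I - {k}. z - x l) / \<Delta> k) \<le> (1 + diameter E / \<delta>) * L" if k: "k \<in> I" for k
  proof -
    have pos: "cmod (z - x k) > 0" "cmod (z - x j) > 0"
      using dist[OF k] dist[OF j] \<open>\<delta> > 0\<close> by linarith+
    have whole: "(z - x i) * (\<Prod>l\<in>I - {i}. z - x l) = (\<Prod>l\<in>I. z - x l)" if "i \<in> I" for i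
      using I(1) that by (simp add: prod.remove[of I i])
    have "cmod (\<Prod>l\<in>I - {k}. z - x l) * cmod (z - x k) = L * cmod (\<Delta> j) * cmod (z - x j)"
    proof -
      have "L * cmod (\<Delta> j) = cmod (\<Prod>l\<in>I - {j}. z - x l)"
        using \<Delta>[OF j] by (simp add: L_def poly_with_zeros_def norm_mult norm_divide)
      then show ?thesis
        using whole[OF k] whole[OF j] by (metis norm_mult mult.commute)
    qed
    then have "cmod ((\<Prod>l\<in>I - {k}. z - x l) / \<Delta> k)
        = L * (cmod (\<Delta> j) / cmod (\<Delta> k)) * (cmod (z - x j) / cmod (z - x k))"
      using pos \<Delta>[OF k] by (simp add: norm_divide field_simps)
    also have "\<dots> \<le> L * 1 * (1 + diameter E / \<delta>)"
    proof (intro mult_mono)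
      show "cmod (\<Delta> j) / cmod (\<Delta> k) \<le> 1"
        using min[OF k] \<Delta>[OF k] by (simp add: \<Delta>_def)
      have "cmod (z - x j) \<le> cmod (z - x k) + cmod (x k - x j)"
        using norm_triangle_ineq[of "z - x k" "x k - x j"] by simp
      also have "cmod (x k - x j) \<le> diameter E"
        using diameter_bounded_bound[OF E, of "x k" "x j"] I(3) j k by (auto simp: dist_norm)
      finally have "cmod (z - x j) / cmod (z - x k) \<le> 1 + diameter E / cmod (z - x k)"
        using pos by (simp add: field_simps)
      also have "\<dots> \<le> 1 + diameter E / \<delta>"
        using dist[OF k] pos(1) \<open>\<delta> > 0\<close> diameter_ge_0[OF E] by (intro add_left_mono divide_left_mono) auto
      finally show "cmod (z - x j) / cmod (z - x k) \<le> 1 + diameter E / \<delta>" .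
    qed (use diameter_ge_0[OF E] \<open>\<delta> > 0\<close> in \<open>auto simp: L_def\<close>)
    finally show ?thesis by (simp add: mult.commute)
  qed
  then have "(\<Sum>k\<in>I. cmod ((\<Prod>l\<in>I - {k}. z - x l) / \<Delta> k)) \<le> real (card I) * ((1 + diameter E / \<delta>) * L)"
    by (rule sum_bounded_above)
  moreover have "1 = cmod (\<Sum>k\<in>I. (\<Prod>l\<in>I - {k}. z - x l) / \<Delta> k)"
  proof -
    have "I \<noteq> {}" using j by blast
    then show ?thesis
      unfolding \<Delta>_def using sum_lagrange_basis_eq_1[OF I(1) _ I(2), of z] by simp
  qed
  ultimately have "1 \<le> real (card I) * ((1 + diameter E / \<delta>) * L)"
    using norm_sum[of "\<lambda>k. (\<Prod>l\<in>I - {k}. z - x l) / \<Delta> k" I] by linarith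
  then show ?thesis by (simp add: L_def \<Delta>_def mult.assoc)
qed

text \<open>This is where the exponent \<open>1/3\<close> in \<open>\<Theta>(E)\<close> comes from:
  \<open>(n + 1) (1 + n\<^sup>2 d) \<le> (n + 1)\<^sup>3 (2 + d)\<close>.\<close>

lemma ln_node_constant_le:
  assumes "bounded E" "n \<ge> 1"
  shows "ln ((real n + 1) * (1 + diameter E / (1 / (real n)\<^sup>2))) \<le> 3 * ln ((real n + 1) * Theta E)"
proof -
  define d where "d = diameter E"
  have d: "d \<ge> 0" using assms(1) by (simp add: d_def diameter_ge_0)
  have "3 * ln ((real n + 1) * Theta E) = 3 * ln (real n + 1) + ln (2 + d)"
    using d by (simp add: Theta_def ln_mult ln_powr d_def)
  also have "\<dots> = ln ((real n + 1) ^ 3 * (2 + d))"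
    using d by (simp add: ln_mult ln_realpow)
  finally have eq: "3 * ln ((real n + 1) * Theta E) = ln ((real n + 1) ^ 3 * (2 + d))" .
  have "1 + d * (real n)\<^sup>2 \<le> (real n + 1)\<^sup>2 * (2 + d)"
  proof -
    have "(real n)\<^sup>2 * d \<le> (real n + 1)\<^sup>2 * d" using d by (intro mult_right_mono power_mono) auto
    moreover have "1 \<le> (real n + 1)\<^sup>2" by (simp add: one_le_power)
    ultimately show ?thesis unfolding distrib_left by (simp only: mult.commute[of d])
  qed
  then have "(real n + 1) * (1 + d * (real n)\<^sup>2) \<le> (real n + 1) ^ 3 * (2 + d)"
    by (simp add: power3_eq_cube power2_eq_square mult.assoc)
  moreover have "0 < (real n + 1) * (1 + d * (real n)\<^sup>2)" using d by (simp add: add_pos_nonneg)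
  ultimately show ?thesis
    unfolding eq by (simp add: d_def)
qed

section \<open>Estimates for arbitrary arrays\<close>

theorem theorem3p19:
  fixes E :: "complex set" and \<omega> :: "real \<Rightarrow> real"
    and \<zeta> :: "nat \<Rightarrow> nat \<Rightarrow> complex" and j :: "nat \<Rightarrow> nat"
  assumes "compact E" and "polynomially_convex E" and "regular_set E"
    and "green_modulus_of_continuity E \<omega>"
    and "array_in E \<zeta>"
    and "\<And>n. n \<ge> 1 \<Longrightarrow> j n \<in> {0..n} \<and>
           cmod (node_delta \<zeta> n (j n)) = Min ((\<lambda>k. cmod (node_delta \<zeta> n k)) ` {0..n})"
  shows "\<forall>n\<ge>1. \<forall>z\<in>{z. infdist z E \<ge> 1 / (real n)\<^sup>2}.
      (1 / real n * ln (1 / sup_norm_on E (node_poly \<zeta> j n))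
         \<le> green E z - ln (root n (cmod (node_poly \<zeta> j n z))) \<and>
       green E z - ln (root n (cmod (node_poly \<zeta> j n z)))
         \<le> 3 / real n * ln ((real n + 1) * Theta E) + \<omega> (1 / (real n)\<^sup>2)) \<and>
      (1 / real n * ln (1 / sup_norm_on E (node_poly \<zeta> j n))
         \<le> ln (cmod (node_delta \<zeta> n (j n)) powr (1 / real n) / log_capacity E) \<and>
       ln (cmod (node_delta \<zeta> n (j n)) powr (1 / real n) / log_capacity E)
         \<le> 3 / real n * ln ((real n + 1) * Theta E) + \<omega> (1 / (real n)\<^sup>2))"
proof (intro allI impI ballI, goal_cases)
  case (1 n z)
  then have n: "n \<ge> 1" and z: "infdist z E \<ge> 1 / (real n)\<^sup>2" by auto
  define \<Delta> where "\<Delta> = node_delta \<zeta> n (j n)"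
  define I where "I = {0..n} - {j n}"
  define L where "L = poly_with_zeros (1 / \<Delta>) I (\<zeta> n)"
  define \<delta> where "\<delta> = 1 / (real n)\<^sup>2"
  define N where "N = sup_norm_on E L"
  define B where "B = 3 / real n * ln ((real n + 1) * Theta E) + \<omega> \<delta>"
  have nodes: "inj_on (\<zeta> n) {0..n}" "\<zeta> n ` {0..n} \<subseteq> E"
    using \<open>array_in E \<zeta>\<close> n by (auto simp: array_in_def)
  have j: "j n \<in> {0..n}" using assms(6)[OF n] by simp
  have min: "cmod \<Delta> \<le> cmod (node_delta \<zeta> n k)" if "k \<in> {0..n}" for k
    using assms(6)[OF n] that by (simp add: \<Delta>_def)
  have L: "node_poly \<zeta> j n = L"
    by (simp add: fun_eq_iff node_poly_def L_def poly_with_zeros_def \<Delta>_def I_def)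
  have "\<Delta> \<noteq> 0"
    using nodes(1) j by (auto simp: \<Delta>_def node_delta_def inj_on_def)
  have I: "finite I" "1 / \<Delta> \<noteq> 0" "\<zeta> n ` I \<subseteq> E"
    using nodes \<open>\<Delta> \<noteq> 0\<close> by (auto simp: I_def)
  have card: "card I = n" using j by (simp add: I_def)
  have "\<delta> > 0" using n by (simp add: \<delta>_def)
  have node_E: "\<zeta> n (j n) \<in> E" using nodes(2) j by blast
  then have "E \<noteq> {}" by blast
  have "bounded E" using assms(1) by (rule compact_imp_bounded)
  have "L (\<zeta> n (j n)) = 1"
    using \<open>\<Delta> \<noteq> 0\<close> by (simp add: L_def poly_with_zeros_def \<Delta>_def I_def node_delta_def)
  moreover have "cmod (L (\<zeta> n (j n))) \<le> N"
    unfolding N_def L_def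
    by (intro cmod_le_sup_norm_on assms(1) continuous_on_poly_with_zeros node_E)
  ultimately have "N > 0" by simp
  have lower: "- ln N \<le> n * green E w - ln (cmod (L w))" if "infdist w E \<ge> \<delta>" for w
  proof -
    have "w \<notin> E" using that \<open>\<delta> > 0\<close> by auto
    then have "ln (cmod (L w)) \<le> real n * green E w + ln N"
      using bernstein_walsh[OF assms(1-3) I node_E, of w] \<open>L (\<zeta> n (j n)) = 1\<close>
      by (simp add: L_def N_def card)
    then show ?thesis by simp
  qed
  have upper: "n * green E w - ln (cmod (L w)) \<le> n * B" if w: "infdist w E \<ge> \<delta>" for w
  proof -
    define K where "K = (real n + 1) * (1 + diameter E / \<delta>)"
    have "K > 0" using diameter_ge_0[OF \<open>bounded E\<close>] \<open>\<delta> > 0\<close> by (simp add: K_def add_pos_nonneg)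
    have "real (card I) * green E w \<le> ln (cmod (L w)) + (ln K + n * \<omega> \<delta>)"
      unfolding L_def
    proof (rule green_le_ln_poly_of_level_set[OF assms(1-3) \<open>E \<noteq> {}\<close> I \<open>\<delta> > 0\<close> _ w])
      fix \<xi> assume \<xi>: "infdist \<xi> E = \<delta>"
      have "1 \<le> K * cmod (L \<xi>)"
        using lagrange_basis_lower_bound[OF _ nodes \<open>bounded E\<close> \<open>\<delta> > 0\<close> _ j, of \<xi>] \<xi> min
        by (simp add: K_def L_def I_def \<Delta>_def node_delta_def add.commute)
      moreover from this have "cmod (L \<xi>) > 0" by (cases "L \<xi> = 0") auto
      ultimately have "0 \<le> ln K + ln (cmod (L \<xi>))"
        using \<open>K > 0\<close> by (metis ln_ge_zero ln_mult_pos)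
      moreover have "green E \<xi> \<le> \<omega> \<delta>"
        by (rule green_le_modulus_at_distance[OF assms(1-3) \<open>E \<noteq> {}\<close> assms(4) \<open>\<delta> > 0\<close> \<xi>])
      then have "n * green E \<xi> \<le> n * \<omega> \<delta>" by (intro mult_left_mono) auto
      ultimately show "real (card I) * green E \<xi>
          \<le> ln (cmod (poly_with_zeros (1 / \<Delta>) I (\<zeta> n) \<xi>)) + (ln K + n * \<omega> \<delta>)"
        by (simp add: card L_def)
    qed
    moreover have "ln K \<le> 3 * ln ((real n + 1) * Theta E)"
      unfolding K_def \<delta>_def by (rule ln_node_constant_le[OF \<open>bounded E\<close> n])
    moreover have "n * B = 3 * ln ((real n + 1) * Theta E) + n * \<omega> \<delta>"
      using n by (simp add: B_def distrib_left)
    ultimately show ?thesis by (simp add: card)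
  qed
  \<comment> \<open>The leading coefficient of \<open>L\<close> is \<open>1 / \<Delta>\<close>, so passing to infinity in \<open>lower\<close> and \<open>upper\<close>
      yields the bounds for \<open>\<Delta>\<close>.\<close>
  have limit: "((\<lambda>w. n * green E w - ln (cmod (L w)))
      \<longlongrightarrow> n * robin_constant E + ln (cmod \<Delta>)) at_infinity"
    using green_minus_ln_poly_tendsto[OF assms(3) I(1,2), of "\<zeta> n"] \<open>\<Delta> \<noteq> 0\<close>
    by (simp add: card L_def norm_divide ln_div)
  have far: "\<forall>\<^sub>F w in at_infinity. infdist w E \<ge> \<delta>"
  proof -
    obtain b where b: "\<And>x. x \<in> E \<Longrightarrow> cmod x \<le> b"
      using \<open>bounded E\<close> by (auto simp: bounded_iff)
    have "\<delta> \<le> infdist w E" if "cmod w \<ge> b + \<delta>" for w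
    proof -
      obtain x where "x \<in> E" "infdist w E = dist w x"
        using infdist_attains_inf[OF compact_imp_closed[OF assms(1)] \<open>E \<noteq> {}\<close>] by metis
      then show ?thesis
        using b[of x] that norm_triangle_ineq2[of w x] by (simp add: dist_norm)
    qed
    then show ?thesis unfolding eventually_at_infinity by blast
  qed
  have limit_bounds: "- ln N \<le> n * robin_constant E + ln (cmod \<Delta>)"
    "n * robin_constant E + ln (cmod \<Delta>) \<le> n * B"
    using tendsto_lowerbound[OF limit eventually_mono[OF far lower] trivial_limit_at_infinity]
      tendsto_upperbound[OF limit eventually_mono[OF far upper] trivial_limit_at_infinity]
    by auto
  have scale: "1 / n * ln (1 / N) \<le> t / n \<and> t / n \<le> B" if "- ln N \<le> t" "t \<le> n * B" for t
    using that n \<open>N > 0\<close> by (simp add: ln_div divide_simps mult.commute)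
  have "green E z - ln (root n (cmod (L z))) = (n * green E z - ln (cmod (L z))) / n"
    using n by (simp add: ln_root diff_divide_distrib)
  moreover have "ln (cmod \<Delta> powr (1 / real n) / log_capacity E)
      = (n * robin_constant E + ln (cmod \<Delta>)) / n"
    using n \<open>\<Delta> \<noteq> 0\<close> by (simp add: log_capacity_def ln_div ln_powr add_divide_distrib)
  ultimately show ?case
    using scale[OF lower upper, of z] scale[OF limit_bounds] z
    unfolding L \<Delta>_def[symmetric] \<delta>_def[symmetric] N_def[symmetric] B_def[symmetric] by simp
qed

end
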